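(* Let $(X,d)$ be a Hadamard space and let $m$ be a positive integer. If $S_i : X \to X$ is a strongly quasi-nonexpansive mapping for all $i \in \{1,\dots,m\}$ and $\bigcap_{i=1}^m Fix(S_i) \neq \emptyset$, then $S = S_m S_{m-1} \cdots S_1$ is a strongly quasi-nonexpansive mapping.
   Context: A Hadamard space is a complete $\mathrm{CAT}(0)$ space. Products of mappings denote composition: $S_m S_{m-1}\cdots S_1 = S_m\circ S_{m-1}\circ\cdots\circ S_1$. For $S : X \to X$, $Fix(S) = \{x \in X : S(x) = x\}$. $S$ is quasi-nonexpansive if $Fix(S) \neq \emptyset$ and $d(S(x),q) \le d(x,q)$ for all $x \in X$ and $q \in Fix(S)$. $S$ is strongly quasi-nonexpansive if $S$ is quasi-nonexpansive and $\lim_{n\to\infty} d(x_n, S(x_n)) = 0$ whenever $\{x_n\}$ is a bounded sequence in $X$ such that $\lim_{n\to\infty}[d(x_n,q) - d(S(x_n),q)] = 0$ for some $q \in Fix(S)$. *)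

theory Defs
  imports "HOL-Analysis.Analysis"
begin

context Metric_space
begin

definition geodesic_path :: "(real \<Rightarrow> 'a) \<Rightarrow> 'a \<Rightarrow> 'a \<Rightarrow> bool" where
  "geodesic_path c x y \<longleftrightarrow>
     c \<in> {0..d x y} \<rightarrow> M \<and> c 0 = x \<and> c (d x y) = y \<and>
     (\<forall>s\<in>{0..d x y}. \<forall>t\<in>{0..d x y}. d (c s) (c t) = \<bar>s - t\<bar>)"

definition geodesic_space :: bool where
  "geodesic_space \<longleftrightarrow> (\<forall>x\<in>M. \<forall>y\<in>M. \<exists>c. geodesic_path c x y)"

text \<open>All pairs of a point \<open>u\<close> on the side \<open>c\<close> from \<open>x\<close> to \<open>y\<close> of a geodesic triangle
  and its comparison point \<open>u'\<close> on the corresponding side \<open>x' y'\<close> of a comparison triangle: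
  \<open>u'\<close> is at the same distance from \<open>x'\<close> as \<open>u\<close> is from \<open>x\<close>.\<close>

definition comparison_pairs ::
    "(real \<Rightarrow> 'a) \<Rightarrow> 'a \<Rightarrow> 'a \<Rightarrow> real^2 \<Rightarrow> real^2 \<Rightarrow> ('a \<times> (real^2)) set" where
  "comparison_pairs c x y x' y' =
     {(u, u'). u \<in> c ` {0..d x y} \<and> u' \<in> closed_segment x' y' \<and> dist x' u' = d x u}"

text \<open>Comparison triangles in the Euclidean plane exist and are unique up to isometry, so
  quantifying over all of them is the same as fixing one for each triangle.\<close>

definition CAT0_inequality :: bool where
  "CAT0_inequality \<longleftrightarrow>
     (\<forall>p\<in>M. \<forall>q\<in>M. \<forall>r\<in>M. \<forall>a b c. \<forall>p' q' r' :: real^2.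
        geodesic_path a p q \<and> geodesic_path b q r \<and> geodesic_path c r p \<and>
        dist p' q' = d p q \<and> dist q' r' = d q r \<and> dist r' p' = d r p \<longrightarrow>
        (let T = comparison_pairs a p q p' q' \<union> comparison_pairs b q r q' r' \<union>
                 comparison_pairs c r p r' p'
         in \<forall>(u, u')\<in>T. \<forall>(v, v')\<in>T. d u v \<le> dist u' v'))"

definition Fix :: "('a \<Rightarrow> 'a) \<Rightarrow> 'a set" where
  "Fix S = {x \<in> M. S x = x}"

definition quasi_nonexpansive :: "('a \<Rightarrow> 'a) \<Rightarrow> bool" where
  "quasi_nonexpansive S \<longleftrightarrow>
     S \<in> M \<rightarrow> M \<and> Fix S \<noteq> {} \<and> (\<forall>x\<in>M. \<forall>q\<in>Fix S. d (S x) q \<le> d x q)"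

definition strongly_quasi_nonexpansive :: "('a \<Rightarrow> 'a) \<Rightarrow> bool" where
  "strongly_quasi_nonexpansive S \<longleftrightarrow>
     quasi_nonexpansive S \<and>
     (\<forall>x :: nat \<Rightarrow> 'a.
        range x \<subseteq> M \<and> mbounded (range x) \<and>
        (\<exists>q\<in>Fix S. (\<lambda>n. d (x n) q - d (S (x n)) q) \<longlonglongrightarrow> 0) \<longrightarrow>
        (\<lambda>n. d (x n) (S (x n))) \<longlonglongrightarrow> 0)"

end

locale CAT0_space = Metric_space +
  assumes geodesic: "geodesic_space"
    and CAT0: "CAT0_inequality"

locale Hadamard_space = CAT0_space +
  assumes complete: "mcomplete"

text \<open>The composition \<open>S m \<circ> S (m - 1) \<circ> \<dots> \<circ> S 1\<close>: the list combinator \<open>fold\<close> applies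
  \<open>S 1\<close> first and \<open>S m\<close> last.\<close>

definition composition :: "(nat \<Rightarrow> 'a \<Rightarrow> 'a) \<Rightarrow> nat \<Rightarrow> 'a \<Rightarrow> 'a" where
  "composition S m = fold S [1..<Suc m]"

lemma composition_Suc: "composition S (Suc m) = S (Suc m) \<circ> composition S m"
  by (simp add: composition_def)

lemma composition_1: "composition S 1 = S 1"
  by (simp add: composition_def)

end

theory Submission
  imports Defs
begin

text \<open>For two maps \<open>S\<close> and \<open>T\<close> with a common fixed point, every \<open>q\<close> in \<open>Fix S \<inter> Fix T\<close> gives
  \<open>d (T (S x)) q \<le> d (S x) q \<le> d x q\<close>, so a vanishing total decrease
  \<open>d x q - d (T (S x)) q\<close> forces both partial decreases to vanish. Strong quasi-nonexpansiveness
  of each factor turns this into \<open>d x (S x) \<rightarrow> 0\<close> and \<open>d (S x) (T (S x)) \<rightarrow> 0\<close>, and the triangle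
  inequality gives the claim for \<open>T \<circ> S\<close>.

  This needs \<open>q\<close> to be fixed by both factors, whereas the definition for \<open>T \<circ> S\<close> only provides a
  fixed point of the composition. The same squeeze, applied to a constant sequence, shows that
  these agree: \<open>Fix (T \<circ> S) = Fix S \<inter> Fix T\<close>. That equality also carries the hypothesis of a
  common fixed point through the induction on the number of maps.\<close>

context Metric_space
begin

lemma quasi_nonexpansiveD:
  assumes "quasi_nonexpansive S"
  shows "x \<in> M \<Longrightarrow> S x \<in> M" and "x \<in> M \<Longrightarrow> q \<in> Fix S \<Longrightarrow> d (S x) q \<le> d x q"
  using assms by (auto simp: quasi_nonexpansive_def)

lemma strongly_quasi_nonexpansiveD:
  assumes "strongly_quasi_nonexpansive S" "range x \<subseteq> M" "mbounded (range x)" "q \<in> Fix S"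
    and "(\<lambda>n. d (x n) q - d (S (x n)) q) \<longlonglongrightarrow> 0"
  shows "(\<lambda>n. d (x n) (S (x n))) \<longlonglongrightarrow> 0"
  using assms unfolding strongly_quasi_nonexpansive_def by blast

lemma quasi_nonexpansive_mbounded_image:
  assumes S: "quasi_nonexpansive S" and A: "A \<subseteq> M" "mbounded A"
  shows "mbounded (S ` A)"
proof -
  obtain q where q: "q \<in> Fix S" using S by (auto simp: quasi_nonexpansive_def)
  then have qM: "q \<in> M" by (simp add: Fix_def)
  then have "mbounded (insert q A)" using A(2) by (simp add: mbounded_insert)
  then obtain B where B: "\<And>a. a \<in> A \<Longrightarrow> d a q \<le> B" by (auto simp: mbounded_alt)
  have "d q (S a) \<le> B" if "a \<in> A" for a
  proof -
    have "d (S a) q \<le> d a q" using quasi_nonexpansiveD(2)[OF S] that A(1) q by blast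
    also have "\<dots> \<le> B" using B that .
    finally show ?thesis by (simp add: commute)
  qed
  then have "S ` A \<subseteq> mcball q B"
    using quasi_nonexpansiveD(1)[OF S] A(1) qM by auto
  then show ?thesis by (auto simp: mbounded_def)
qed

text \<open>A point at which \<open>S\<close> preserves the distance to some fixed point gives a constant sequence
  without decrease, which leaves \<open>S\<close> no room to move it.\<close>

lemma strongly_quasi_nonexpansive_fixed_if_dist_eq:
  assumes S: "strongly_quasi_nonexpansive S" and x: "x \<in> M" and q: "q \<in> Fix S"
    and eq: "d (S x) q = d x q"
  shows "S x = x"
proof -
  have "(\<lambda>n::nat. d x (S x)) \<longlonglongrightarrow> 0"
    using strongly_quasi_nonexpansiveD[OF S, of "\<lambda>_. x", OF _ _ q] x eq
    by (simp add: mbounded_insert)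
  then have "d x (S x) = 0" by (simp add: LIMSEQ_const_iff)
  moreover have "S x \<in> M"
    using S x quasi_nonexpansiveD(1) by (auto simp: strongly_quasi_nonexpansive_def)
  ultimately show ?thesis using x by simp
qed

text \<open>A fixed point \<open>x\<close> of the composition closes up the chain
  \<open>d x p = d (T (S x)) p \<le> d (S x) p \<le> d x p\<close> for a common fixed point \<open>p\<close>, so \<open>S\<close> preserves
  the distance from \<open>x\<close> to \<open>p\<close>.\<close>

lemma Fix_comp_strongly_quasi_nonexpansive:
  assumes S: "strongly_quasi_nonexpansive S" and T: "quasi_nonexpansive T"
    and common: "Fix S \<inter> Fix T \<noteq> {}"
  shows "Fix (T \<circ> S) = Fix S \<inter> Fix T"
proof
  show "Fix S \<inter> Fix T \<subseteq> Fix (T \<circ> S)" by (auto simp: Fix_def)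
next
  have S': "quasi_nonexpansive S" using S by (simp add: strongly_quasi_nonexpansive_def)
  obtain p where p: "p \<in> Fix S" "p \<in> Fix T" using common by blast
  show "Fix (T \<circ> S) \<subseteq> Fix S \<inter> Fix T"
  proof
    fix x assume "x \<in> Fix (T \<circ> S)"
    then have x: "x \<in> M" "T (S x) = x" by (auto simp: Fix_def)
    have "d x p \<le> d (S x) p"
      using quasi_nonexpansiveD(2)[OF T quasi_nonexpansiveD(1)[OF S' x(1)] p(2)] x(2) by simp
    moreover have "d (S x) p \<le> d x p" using quasi_nonexpansiveD(2)[OF S' x(1) p(1)] .
    ultimately have "S x = x"
      using strongly_quasi_nonexpansive_fixed_if_dist_eq[OF S x(1) p(1)] by simp
    then show "x \<in> Fix S \<inter> Fix T" using x by (auto simp: Fix_def)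
  qed
qed

lemma strongly_quasi_nonexpansive_comp:
  assumes S: "strongly_quasi_nonexpansive S" and T: "strongly_quasi_nonexpansive T"
    and common: "Fix S \<inter> Fix T \<noteq> {}"
  shows "strongly_quasi_nonexpansive (T \<circ> S)"
proof -
  have S': "quasi_nonexpansive S" and T': "quasi_nonexpansive T"
    using S T by (simp_all add: strongly_quasi_nonexpansive_def)
  note Fix = Fix_comp_strongly_quasi_nonexpansive[OF S T' common]
  have SM: "S x \<in> M" if "x \<in> M" for x using quasi_nonexpansiveD(1)[OF S' that] .
  have TM: "T x \<in> M" if "x \<in> M" for x using quasi_nonexpansiveD(1)[OF T' that] .
  have S_le: "d (S x) q \<le> d x q" if "x \<in> M" "q \<in> Fix (T \<circ> S)" for x q
    using quasi_nonexpansiveD(2)[OF S'] that Fix by blast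
  have T_le: "d (T (S x)) q \<le> d (S x) q" if "x \<in> M" "q \<in> Fix (T \<circ> S)" for x q
    using quasi_nonexpansiveD(2)[OF T' SM] that Fix by blast
  have "quasi_nonexpansive (T \<circ> S)"
    unfolding quasi_nonexpansive_def
    using SM TM Fix common order_trans[OF T_le S_le] by auto
  moreover have "(\<lambda>n. d (x n) ((T \<circ> S) (x n))) \<longlonglongrightarrow> 0"
    if x: "range x \<subseteq> M" "mbounded (range x)" and q: "q \<in> Fix (T \<circ> S)"
      and lim: "(\<lambda>n. d (x n) q - d ((T \<circ> S) (x n)) q) \<longlonglongrightarrow> 0" for x :: "nat \<Rightarrow> 'a" and q
  proof -
    have xM: "x n \<in> M" for n using x(1) by auto
    have limS: "(\<lambda>n. d (x n) q - d (S (x n)) q) \<longlonglongrightarrow> 0"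
      using S_le[OF xM q] T_le[OF xM q]
      by (intro tendsto_sandwich[OF _ _ tendsto_const lim] always_eventually) auto
    have limT: "(\<lambda>n. d (S (x n)) q - d (T (S (x n))) q) \<longlonglongrightarrow> 0"
      using S_le[OF xM q] T_le[OF xM q]
      by (intro tendsto_sandwich[OF _ _ tendsto_const lim] always_eventually) auto
    have "(\<lambda>n. d (x n) (S (x n))) \<longlonglongrightarrow> 0"
      using strongly_quasi_nonexpansiveD[OF S x _ limS] q Fix by blast
    moreover have "(\<lambda>n. d (S (x n)) (T (S (x n)))) \<longlonglongrightarrow> 0"
    proof (rule strongly_quasi_nonexpansiveD[OF T _ _ _ limT])
      show "range (\<lambda>n. S (x n)) \<subseteq> M" using SM xM by auto
      show "mbounded (range (\<lambda>n. S (x n)))"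
        using quasi_nonexpansive_mbounded_image[OF S' x] by (simp add: image_image)
      show "q \<in> Fix T" using q Fix by blast
    qed
    ultimately have "(\<lambda>n. d (x n) (S (x n)) + d (S (x n)) (T (S (x n)))) \<longlonglongrightarrow> 0"
      using tendsto_add by fastforce
    then show ?thesis
      by (rule tendsto_sandwich[OF _ _ tendsto_const, rotated 2])
        (auto intro!: always_eventually triangle xM SM TM)
  qed
  ultimately show ?thesis unfolding strongly_quasi_nonexpansive_def by blast
qed

text \<open>The fixed points of the partial compositions are determined in the same induction, because
  the step for two maps asks for a point fixed by the partial composition and the next map.\<close>

lemma strongly_quasi_nonexpansive_composition:
  assumes "m \<ge> 1"
    and "\<And>i. i \<in> {1..m} \<Longrightarrow> strongly_quasi_nonexpansive (S i)"
    and "(\<Inter>i\<in>{1..m}. Fix (S i)) \<noteq> {}"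
  shows "strongly_quasi_nonexpansive (composition S m) \<and>
    Fix (composition S m) = (\<Inter>i\<in>{1..m}. Fix (S i))"
  using assms
proof (induction m rule: dec_induct)
  case base
  then show ?case using composition_1[of S] by simp
next
  case (step k)
  have split: "(\<Inter>i\<in>{1..Suc k}. Fix (S i)) = (\<Inter>i\<in>{1..k}. Fix (S i)) \<inter> Fix (S (Suc k))"
    by (auto simp: atLeastAtMostSuc_conv)
  have IH: "strongly_quasi_nonexpansive (composition S k)"
    "Fix (composition S k) = (\<Inter>i\<in>{1..k}. Fix (S i))"
    using step.IH step.prems split by auto
  have next_map: "strongly_quasi_nonexpansive (S (Suc k))" using step.prems(1) by simp
  have common: "Fix (composition S k) \<inter> Fix (S (Suc k)) \<noteq> {}"
    using step.prems(2) split IH(2) by simp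
  have "strongly_quasi_nonexpansive (composition S (Suc k))"
    unfolding composition_Suc by (rule strongly_quasi_nonexpansive_comp[OF IH(1) next_map common])
  moreover have "Fix (composition S (Suc k)) = (\<Inter>i\<in>{1..Suc k}. Fix (S i))"
    using Fix_comp_strongly_quasi_nonexpansive[OF IH(1) _ common] next_map
    unfolding composition_Suc split IH(2) by (simp add: strongly_quasi_nonexpansive_def)
  ultimately show ?case by blast
qed

end

theorem lemma4:
  fixes X :: "'a set" and d :: "'a \<Rightarrow> 'a \<Rightarrow> real" and m :: nat and S :: "nat \<Rightarrow> 'a \<Rightarrow> 'a"
  assumes "Hadamard_space X d"
    and "m \<ge> 1"
    and "\<And>i. i \<in> {1..m} \<Longrightarrow> Metric_space.strongly_quasi_nonexpansive X d (S i)"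
    and "(\<Inter>i\<in>{1..m}. Metric_space.Fix X (S i)) \<noteq> {}"
  shows "Metric_space.strongly_quasi_nonexpansive X d (composition S m)"
proof -
  interpret Hadamard_space X d by fact
  show ?thesis using strongly_quasi_nonexpansive_composition[OF assms(2-4)] by blast
qed

end
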